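(* Let $t_\beta$ and $t_\eta$ be the direct $\beta$- and $\eta$-witnesses from $M=((\lambda z.\,xz)\,y)$ to $N=xy$. In the canonical identity-type higher tower on $K_\infty$, their canonical interpretations $[\![t_\beta]\!]_{K_\infty}$ and $[\![t_\eta]\!]_{K_\infty}$ are: (i) distinct as $K_\infty$-points; (ii) not connected by any $1$-cell, i.e., by any equality in the carrier of $K_\infty$; (iii) consequently not connected by any higher cell in any positive dimension of that tower. The same conclusion holds for any pair of witnesses in the fixed-span language $W(M,N)$ whose canonical tags are $\beta$ and $\eta$, respectively.
   Context: $K_\infty=\varprojlim_n K_n$ is the inverse limit of $K_0=N^+$ (flat domain on $\bigsqcup_{n\ge0}S^n$ plus bottom), $K_{n+1}=[K_n\to K_n]$, along projection pairs $(f_n^+,f_n^-)$; $f_{0,\infty}:K_0\to K_\infty$ is the canonical stage embedding and $\pi_0$ the $0$th projection. The canonical higher tower on $K_\infty$ is the identity-type tower: $1$-cells $x\to y$ are equalities $x=y$, higher cells iterated equalities. On the span $M=((\lambda z.\,xz)\,y)\to N=xy$ there are two one-step witnesses: $t_\beta$ (the $\beta$-contraction) and $t_\eta$ ($\eta$-contraction $\lambda z.\,xz\to_\eta x$ in the function part). $W(A,B)$ for $A,B\in\{M,N\}$ is the typed family generated by $t_\beta,t_\eta:W(M,N)$, $\mathsf{refl}_M,\mathsf{refl}_N$, and composition (no inverses). Every $t\in W(M,N)$ is the direct $\beta$- or $\eta$-witness padded by reflexive witnesses, giving a well-defined tag $\mathrm{tag}(t)\in\{\beta,\eta\}$. With $s^R_1,s^L_1$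 the right and left poles of the $S^1$-summand of $K_0$'s base, the interpretation $[\![t]\!]_{K_\infty}$ (semantic interpretation of $t$ in $K_\infty$) is $f_{0,\infty}(s^R_1)$ if $\mathrm{tag}(t)=\beta$ and $f_{0,\infty}(s^L_1)$ if $\mathrm{tag}(t)=\eta$. *)

theory Defs
  imports "HOL-Analysis.Abstract_Euclidean_Space" "HOL-Library.FSet"
begin

section \<open>Scott continuity\<close>

text \<open>All posets below are families of sets ordered by inclusion.\<close>

definition directed :: "'a set set \<Rightarrow> bool" where
  "directed D \<longleftrightarrow> D \<noteq> {} \<and> (\<forall>a\<in>D. \<forall>b\<in>D. \<exists>c\<in>D. a \<subseteq> c \<and> b \<subseteq> c)"

definition is_lub_in :: "'a set set \<Rightarrow> 'a set set \<Rightarrow> 'a set \<Rightarrow> bool" where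
  "is_lub_in A D u \<longleftrightarrow>
     u \<in> A \<and> (\<forall>d\<in>D. d \<subseteq> u) \<and> (\<forall>v\<in>A. (\<forall>d\<in>D. d \<subseteq> v) \<longrightarrow> u \<subseteq> v)"

definition scott_cont :: "'a set set \<Rightarrow> 'b set set \<Rightarrow> ('a set \<Rightarrow> 'b set) \<Rightarrow> bool" where
  "scott_cont A B f \<longleftrightarrow>
     f ` A \<subseteq> B \<and>
     (\<forall>D u. D \<subseteq> A \<longrightarrow> directed D \<longrightarrow> is_lub_in A D u \<longrightarrow> is_lub_in B (f ` D) (f u))"


section \<open>The tower of function spaces\<close>

text \<open>
  The domains \<open>K\<^sub>0\<close>, \<open>K\<^sub>1 = [K\<^sub>0 \<rightarrow> K\<^sub>0]\<close>, \<open>K\<^sub>2 = [K\<^sub>1 \<rightarrow> K\<^sub>1]\<close>, ... have to live in one HOL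
  type. An element is represented by the set of its finite pieces of information: a base
  point \<open>s\<close> by \<open>{Point s}\<close>, bottom of \<open>K\<^sub>0\<close> by \<open>{}\<close>, and a continuous function by its graph,
  which contains \<open>Step \<beta> b\<close> iff \<open>b\<close> belongs to the value at every argument containing the
  finite set \<open>\<beta>\<close>. The theorems \<open>fun_apply_code\<close>, \<open>fun_code_apply\<close> and \<open>fun_code_subset_iff\<close>
  below state that at every stage graphs and Scott-continuous functions correspond to each
  other, inclusion of graphs being the pointwise order.
\<close>

type_synonym point = "nat \<times> (nat \<Rightarrow> real)"

datatype token = Point point | Step "token fset" token

type_synonym elem = "token set"

definition fun_code :: "elem set \<Rightarrow> (elem \<Rightarrow> elem) \<Rightarrow> elem" where
  "fun_code A f = {Step \<beta> b | \<beta> b. \<forall>x\<in>A. fset \<beta> \<subseteq> x \<longrightarrow> b \<in> f x}"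

definition fun_apply :: "elem \<Rightarrow> elem \<Rightarrow> elem" where
  "fun_apply g x = {b. \<exists>\<beta>. fset \<beta> \<subseteq> x \<and> Step \<beta> b \<in> g}"

definition sphere_points :: "point set" where
  "sphere_points = (SIGMA n:UNIV. topspace (nsphere n))"

primrec K :: "nat \<Rightarrow> elem set" where
  "K 0 = insert {} ((\<lambda>s. {Point s}) ` sphere_points)"
| "K (Suc n) = fun_code (K n) ` {f. scott_cont (K n) (K n) f}"

subsection \<open>Graphs represent exactly the Scott-continuous functions\<close>

definition closed_family :: "'a set set \<Rightarrow> bool" where
  "closed_family A \<longleftrightarrow>
     (\<forall>D. D \<subseteq> A \<longrightarrow> directed D \<longrightarrow> \<Union>D \<in> A) \<and> (\<forall>S. S \<subseteq> A \<longrightarrow> S \<noteq> {} \<longrightarrow> \<Inter>S \<in> A)"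

lemma is_lub_in_iff:
  assumes "closed_family A" "D \<subseteq> A" "directed D"
  shows "is_lub_in A D u \<longleftrightarrow> u = \<Union>D"
proof -
  have "\<Union>D \<in> A" using assms by (simp add: closed_family_def)
  then show ?thesis
    unfolding is_lub_in_def by (intro iffI) (rule subset_antisym, blast, blast, blast)
qed

lemma scott_cont_mono:
  assumes f: "scott_cont A B f" and "x \<in> A" "y \<in> A" "x \<subseteq> y"
  shows "f x \<subseteq> f y"
proof -
  have "directed {x, y}" "is_lub_in A {x, y} y" "{x, y} \<subseteq> A"
    using assms by (auto simp: directed_def is_lub_in_def)
  then have "is_lub_in B (f ` {x, y}) (f y)" using f unfolding scott_cont_def by blast
  then show ?thesis by (simp add: is_lub_in_def)
qed

lemma directed_image:
  assumes "directed D" "D \<subseteq> A" "\<And>x y. x \<in> A \<Longrightarrow> y \<in> A \<Longrightarrow> x \<subseteq> y \<Longrightarrow> f x \<subseteq> f y"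
  shows "directed (f ` D)"
  unfolding directed_def
proof (intro conjI ballI)
  show "f ` D \<noteq> {}" using assms by (simp add: directed_def)
  fix a b assume "a \<in> f ` D" "b \<in> f ` D"
  then obtain x y where xy: "x \<in> D" "y \<in> D" "a = f x" "b = f y" by blast
  then obtain z where z: "z \<in> D" "x \<subseteq> z" "y \<subseteq> z" using assms(1) unfolding directed_def by blast
  note in_A = subsetD[OF assms(2)]
  have "f x \<subseteq> f z" "f y \<subseteq> f z" by (simp_all add: assms(3) in_A xy z)
  then show "\<exists>c\<in>f ` D. a \<subseteq> c \<and> b \<subseteq> c" using xy z(1) by blast
qed

lemma scott_cont_iff:
  assumes A: "closed_family A" and B: "closed_family B"
  shows "scott_cont A B f \<longleftrightarrow> f ` A \<subseteq> B \<and> (\<forall>x\<in>A. \<forall>y\<in>A. x \<subseteq> y \<longrightarrow> f x \<subseteq> f y) \<and>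
     (\<forall>D. D \<subseteq> A \<longrightarrow> directed D \<longrightarrow> f (\<Union>D) = \<Union>(f ` D))" (is "_ \<longleftrightarrow> ?R")
proof
  assume f: "scott_cont A B f"
  then have m: "\<forall>x\<in>A. \<forall>y\<in>A. x \<subseteq> y \<longrightarrow> f x \<subseteq> f y" by (blast dest: scott_cont_mono)
  have "f (\<Union>D) = \<Union>(f ` D)" if D: "D \<subseteq> A" "directed D" for D
  proof -
    have d: "directed (f ` D)" using D m by (intro directed_image[of D A]) auto
    have "is_lub_in B (f ` D) (f (\<Union>D))"
      using f D is_lub_in_iff[OF A D] unfolding scott_cont_def by blast
    moreover have "f ` D \<subseteq> B" using f D by (auto simp: scott_cont_def)
    ultimately show ?thesis using is_lub_in_iff[OF B _ d] by blast
  qed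
  then show ?R using m f by (simp add: scott_cont_def)
next
  assume ?R
  then have R: "f ` A \<subseteq> B" "\<And>x y. x \<in> A \<Longrightarrow> y \<in> A \<Longrightarrow> x \<subseteq> y \<Longrightarrow> f x \<subseteq> f y"
    "\<And>D. D \<subseteq> A \<Longrightarrow> directed D \<Longrightarrow> f (\<Union>D) = \<Union>(f ` D)" by simp_all
  have "is_lub_in B (f ` D) (f u)" if D: "D \<subseteq> A" "directed D" "is_lub_in A D u" for D u
  proof -
    have d: "directed (f ` D)" using D(2,1) R(2) by (rule directed_image)
    have "f ` D \<subseteq> B" using image_mono[OF D(1)] R(1) by (rule order_trans)
    moreover have "f u = \<Union>(f ` D)" using R(3)[OF D(1,2)] D(3) is_lub_in_iff[OF A D(1,2)] by simp
    ultimately show ?thesis using is_lub_in_iff[OF B _ d] by simp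
  qed
  then show "scott_cont A B f" unfolding scott_cont_def using R(1) by simp
qed

lemma scott_cont_maps: "scott_cont A B f \<Longrightarrow> x \<in> A \<Longrightarrow> f x \<in> B"
  by (auto simp: scott_cont_def)

lemma scott_cont_Union:
  assumes "closed_family A" "closed_family B" "scott_cont A B f" "D \<subseteq> A" "directed D"
  shows "f (\<Union>D) = \<Union>(f ` D)"
  using assms(3-5) scott_cont_iff[OF assms(1,2), of f] by simp

lemma scott_contI:
  assumes "closed_family A" "closed_family B"
    and "\<And>x. x \<in> A \<Longrightarrow> f x \<in> B"
    and "\<And>x y. x \<in> A \<Longrightarrow> y \<in> A \<Longrightarrow> x \<subseteq> y \<Longrightarrow> f x \<subseteq> f y"
    and "\<And>D. D \<subseteq> A \<Longrightarrow> directed D \<Longrightarrow> f (\<Union>D) \<subseteq> \<Union>(f ` D)"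
  shows "scott_cont A B f"
proof -
  have "\<Union>(f ` D) \<subseteq> f (\<Union>D)" if D: "D \<subseteq> A" "directed D" for D
  proof -
    have "\<Union>D \<in> A" using assms(1) D by (simp add: closed_family_def)
    then have "f d \<subseteq> f (\<Union>D)" if "d \<in> D" for d using assms(4) that D(1) by blast
    then show ?thesis by blast
  qed
  then have "f (\<Union>D) = \<Union>(f ` D)" if "D \<subseteq> A" "directed D" for D
    using assms(5) that by (simp add: subset_antisym)
  then show ?thesis unfolding scott_cont_iff[OF assms(1,2)] using assms(3,4) by auto
qed

definition least_above :: "'a set set \<Rightarrow> 'a set \<Rightarrow> 'a set" where
  "least_above A F = \<Inter>{x \<in> A. F \<subseteq> x}"

lemma least_above:
  assumes "closed_family A" "x \<in> A" "F \<subseteq> x"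
  shows "least_above A F \<in> A" "F \<subseteq> least_above A F" "least_above A F \<subseteq> x"
proof -
  have "{x \<in> A. F \<subseteq> x} \<subseteq> A" "{x \<in> A. F \<subseteq> x} \<noteq> {}" using assms by auto
  then show "least_above A F \<in> A" using assms(1) unfolding closed_family_def least_above_def by blast
qed (use assms in \<open>auto simp: least_above_def\<close>)

lemma finite_approximants:
  assumes A: "closed_family A" and x: "x \<in> A"
  defines "D \<equiv> {least_above A (fset \<beta>) | \<beta>. fset \<beta> \<subseteq> x}"
  shows "D \<subseteq> A" "directed D" "\<Union>D = x"
proof -
  show DA: "D \<subseteq> A" using least_above[OF A x] by (auto simp: D_def)
  show "directed D" unfolding directed_def
  proof (intro conjI ballI)
    have "least_above A (fset {||}) \<in> D" unfolding D_def by force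
    then show "D \<noteq> {}" by blast
    fix a b assume "a \<in> D" "b \<in> D"
    then obtain \<beta> \<gamma> where h: "fset \<beta> \<subseteq> x" "fset \<gamma> \<subseteq> x"
      "a = least_above A (fset \<beta>)" "b = least_above A (fset \<gamma>)" by (auto simp: D_def)
    let ?c = "least_above A (fset (\<beta> |\<union>| \<gamma>))"
    have u: "fset (\<beta> |\<union>| \<gamma>) \<subseteq> x" using h by auto
    then have "?c \<in> D" unfolding D_def by blast
    moreover have "fset \<beta> \<subseteq> ?c" "fset \<gamma> \<subseteq> ?c" "?c \<in> A" using least_above[OF A x u] by auto
    then have "a \<subseteq> ?c" "b \<subseteq> ?c" using h least_above(3)[OF A] by blast+
    ultimately show "\<exists>c\<in>D. a \<subseteq> c \<and> b \<subseteq> c" by blast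
  qed
  show "\<Union>D = x"
  proof
    show "\<Union>D \<subseteq> x" using least_above(3)[OF A x] by (auto simp: D_def)
    show "x \<subseteq> \<Union>D"
    proof
      fix b assume "b \<in> x"
      then have "fset {|b|} \<subseteq> x" by simp
      then have "least_above A (fset {|b|}) \<in> D" "b \<in> least_above A (fset {|b|})"
        using least_above(2)[OF A x] unfolding D_def by (blast, auto)
      then show "b \<in> \<Union>D" by blast
    qed
  qed
qed

lemma Step_in_fun_code [simp]:
  "Step \<beta> b \<in> fun_code A f \<longleftrightarrow> (\<forall>x\<in>A. fset \<beta> \<subseteq> x \<longrightarrow> b \<in> f x)"
  by (simp add: fun_code_def)

lemma fun_code_eqI:
  "(\<And>x. x \<in> A \<Longrightarrow> f x = g x) \<Longrightarrow> fun_code A f = fun_code A g"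
  by (auto simp: fun_code_def)

lemma fun_apply_code_family:
  assumes A: "closed_family A" and f: "scott_cont A A f" and x: "x \<in> A"
  shows "fun_apply (fun_code A f) x = f x"
proof
  show "fun_apply (fun_code A f) x \<subseteq> f x" using x by (auto simp: fun_apply_def)
  show "f x \<subseteq> fun_apply (fun_code A f) x"
  proof
    fix b assume b: "b \<in> f x"
    let ?D = "{least_above A (fset \<beta>) | \<beta>. fset \<beta> \<subseteq> x}"
    note D = finite_approximants[OF A x]
    have "f x = \<Union>(f ` ?D)" using scott_cont_Union[OF A A f D(1,2)] D(3) by simp
    then obtain \<beta> where \<beta>: "fset \<beta> \<subseteq> x" "b \<in> f (least_above A (fset \<beta>))" using b by auto
    have "b \<in> f z" if "z \<in> A" "fset \<beta> \<subseteq> z" for z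
      using \<beta>(2) scott_cont_mono[OF f _ that(1)] least_above[OF A that] by blast
    then show "b \<in> fun_apply (fun_code A f) x" using \<beta> by (auto simp: fun_apply_def)
  qed
qed

lemma fun_apply_mono: "g \<subseteq> h \<Longrightarrow> fun_apply g x \<subseteq> fun_apply h x"
  by (auto simp: fun_apply_def)

lemma fun_apply_Union: "fun_apply (\<Union>S) x = (\<Union>g\<in>S. fun_apply g x)"
  by (auto simp: fun_apply_def)

lemma fun_code_subset_iff_family:
  assumes A: "closed_family A" and f: "scott_cont A A f" and g: "scott_cont A A g"
  shows "fun_code A f \<subseteq> fun_code A g \<longleftrightarrow> (\<forall>x\<in>A. f x \<subseteq> g x)"
proof
  assume "fun_code A f \<subseteq> fun_code A g"
  then show "\<forall>x\<in>A. f x \<subseteq> g x"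
    using fun_apply_mono fun_apply_code_family[OF A f] fun_apply_code_family[OF A g] by metis
qed (fastforce simp: fun_code_def)

lemma fun_code_apply_family:
  assumes A: "closed_family A" and g: "g \<in> fun_code A ` {f. scott_cont A A f}"
  shows "scott_cont A A (fun_apply g)" "fun_code A (fun_apply g) = g"
proof -
  obtain f where f: "scott_cont A A f" "g = fun_code A f" using g by blast
  note e = fun_apply_code_family[OF A f(1), folded f(2)]
  show "scott_cont A A (fun_apply g)"
  proof (rule scott_contI[OF A A])
    show "fun_apply g x \<in> A" if "x \<in> A" for x
      using e[OF that] scott_cont_maps[OF f(1) that] by simp
    show "fun_apply g x \<subseteq> fun_apply g y" if "x \<in> A" "y \<in> A" "x \<subseteq> y" for x y
      using e that scott_cont_mono[OF f(1) that] by simp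
    show "fun_apply g (\<Union>D) \<subseteq> \<Union>(fun_apply g ` D)" if D: "D \<subseteq> A" "directed D" for D
    proof -
      have "\<Union>D \<in> A" using A D by (simp add: closed_family_def)
      then have "fun_apply g (\<Union>D) = \<Union>(f ` D)" using e scott_cont_Union[OF A A f(1) D] by simp
      also have "f ` D = fun_apply g ` D" using e D by (intro image_cong) auto
      finally show ?thesis by simp
    qed
  qed
  show "fun_code A (fun_apply g) = g" using e f(2) fun_code_eqI[of A "fun_apply g" f] by simp
qed

lemma closed_family_fun_space:
  assumes A: "closed_family A"
  shows "closed_family (fun_code A ` {f. scott_cont A A f})" (is "closed_family ?F")
proof -
  have "(directed D \<longrightarrow> \<Union>D \<in> ?F) \<and> (D \<noteq> {} \<longrightarrow> \<Inter>D \<in> ?F)" if DF: "D \<subseteq> ?F" for D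
  proof -
  have Dc: "scott_cont A A (fun_apply g)" "fun_code A (fun_apply g) = g" if "g \<in> D" for g
    using fun_code_apply_family[OF A subsetD[OF DF that]] by simp_all
  have Dm: "fun_apply g x \<in> A" if "g \<in> D" "x \<in> A" for g x
    using scott_cont_maps[OF Dc(1)[OF that(1)] that(2)] .
  have Dmono: "fun_apply g x \<subseteq> fun_apply g y" if "g \<in> D" "x \<in> A" "y \<in> A" "x \<subseteq> y" for g x y
    using scott_cont_mono[OF Dc(1)[OF that(1)] that(2-4)] .
  have U: "\<Union>D \<in> ?F" if d: "directed D"
  proof -
    define h where "h = (\<lambda>x. fun_apply (\<Union>D) x)"
    have hU: "h x = (\<Union>g\<in>D. fun_apply g x)" for x by (simp add: h_def fun_apply_Union)
    have hA: "h x \<in> A" if "x \<in> A" for x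
    proof -
      have "directed ((\<lambda>g. fun_apply g x) ` D)"
        by (rule directed_image[OF d subset_UNIV]) (rule fun_apply_mono)
      moreover have "(\<lambda>g. fun_apply g x) ` D \<subseteq> A" using Dm that by blast
      ultimately show ?thesis using A unfolding closed_family_def hU by blast
    qed
    have hmono: "\<forall>x\<in>A. \<forall>y\<in>A. x \<subseteq> y \<longrightarrow> h x \<subseteq> h y" using Dmono by (fastforce simp: hU)
    have hE: "h (\<Union>E) \<subseteq> \<Union>(h ` E)" if E: "E \<subseteq> A" "directed E" for E
    proof -
      have "fun_apply g (\<Union>E) = \<Union>(fun_apply g ` E)" if "g \<in> D" for g
        using scott_cont_Union[OF A A Dc(1)[OF that] E] .
      then show ?thesis by (simp add: hU) blast
    qed
    have hc: "scott_cont A A h" using hmono by (intro scott_contI[OF A A] hA hE) auto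
    have "\<Union>D = fun_code A h"
    proof (rule set_eqI)
      fix t
      show "t \<in> \<Union>D \<longleftrightarrow> t \<in> fun_code A h"
      proof
        assume "t \<in> \<Union>D"
        then obtain g where g: "g \<in> D" "t \<in> g" by blast
        then have "t \<in> fun_code A (fun_apply g)" using Dc(2)[OF g(1)] by simp
        then show "t \<in> fun_code A h" using g(1) by (fastforce simp: fun_code_def hU)
      next
        assume "t \<in> fun_code A h"
        then obtain \<beta> b where t: "t = Step \<beta> b" "\<forall>x\<in>A. fset \<beta> \<subseteq> x \<longrightarrow> b \<in> h x"
          by (auto simp: fun_code_def)
        show "t \<in> \<Union>D"
        proof (cases "\<exists>x\<in>A. fset \<beta> \<subseteq> x")
          case True
          then obtain x where x: "x \<in> A" "fset \<beta> \<subseteq> x" by blast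
          let ?c = "least_above A (fset \<beta>)"
          obtain g where g: "g \<in> D" "b \<in> fun_apply g ?c"
            using t(2) least_above[OF A x] by (auto simp: hU)
          have "b \<in> fun_apply g z" if "z \<in> A" "fset \<beta> \<subseteq> z" for z
            using g Dmono[OF g(1) _ that(1)] least_above[OF A that] by blast
          then have "t \<in> fun_code A (fun_apply g)" using t(1) by simp
          then show ?thesis using Dc(2)[OF g(1)] g(1) by auto
        next
          case False
          obtain g where g: "g \<in> D" using d by (auto simp: directed_def)
          have "t \<in> fun_code A (fun_apply g)" using False t(1) by auto
          then show ?thesis using Dc(2)[OF g] g by auto
        qed
      qed
    qed
    then show ?thesis using hc by blast
  qed
  have I: "\<Inter>D \<in> ?F" if ne: "D \<noteq> {}"
  proof -
    define m where "m = (\<lambda>F. \<Inter>g\<in>D. fun_apply g (least_above A F))"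
    define h where "h = (\<lambda>x. \<Union>\<beta>\<in>{\<beta>. fset \<beta> \<subseteq> x}. m (fset \<beta>))"
    have mmono: "m F \<subseteq> m G" if "F \<subseteq> G" "G \<subseteq> x" "x \<in> A" for F G x
    proof -
      have "least_above A F \<subseteq> least_above A G" using that by (auto simp: least_above_def)
      moreover have "least_above A F \<in> A" "least_above A G \<in> A"
        using least_above(1)[OF A that(3)] that by auto
      ultimately have "\<forall>g\<in>D. fun_apply g (least_above A F) \<subseteq> fun_apply g (least_above A G)"
        using Dmono by simp
      then show ?thesis unfolding m_def by blast
    qed
    have hA: "h x \<in> A" if x: "x \<in> A" for x
    proof -
      let ?E = "(\<lambda>\<beta>. m (fset \<beta>)) ` {\<beta>. fset \<beta> \<subseteq> x}"
      have "?E \<subseteq> A"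
      proof clarify
        fix \<beta> assume "fset \<beta> \<subseteq> x"
        then have "least_above A (fset \<beta>) \<in> A" using least_above(1)[OF A x] by blast
        then have "(\<lambda>g. fun_apply g (least_above A (fset \<beta>))) ` D \<subseteq> A" using Dm by blast
        then show "m (fset \<beta>) \<in> A" using A ne unfolding closed_family_def m_def by blast
      qed
      moreover have "directed ?E" unfolding directed_def
      proof (intro conjI ballI)
        show "?E \<noteq> {}" by (auto intro!: exI[of _ "{||}"])
        fix a b assume "a \<in> ?E" "b \<in> ?E"
        then obtain \<beta> \<gamma> where bg: "fset \<beta> \<subseteq> x" "fset \<gamma> \<subseteq> x" "a = m (fset \<beta>)" "b = m (fset \<gamma>)" by blast
        then have u: "fset (\<beta> |\<union>| \<gamma>) \<subseteq> x" by auto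
        have "a \<subseteq> m (fset (\<beta> |\<union>| \<gamma>))" "b \<subseteq> m (fset (\<beta> |\<union>| \<gamma>))"
          unfolding bg by (rule mmono[OF _ u x], simp)+
        then show "\<exists>c\<in>?E. a \<subseteq> c \<and> b \<subseteq> c" using u by blast
      qed
      ultimately show ?thesis using A unfolding closed_family_def h_def by blast
    qed
    have hmono: "\<forall>x\<in>A. \<forall>y\<in>A. x \<subseteq> y \<longrightarrow> h x \<subseteq> h y"
      unfolding h_def by (intro ballI impI UN_mono) auto
    have hE: "h (\<Union>E) \<subseteq> \<Union>(h ` E)" if E: "E \<subseteq> A" "directed E" for E
    proof -
      have fin: "\<exists>e\<in>E. F \<subseteq> e" if "finite F" "F \<subseteq> \<Union>E" for F
        using that
      proof (induction F)
        case empty then show ?case using E by (auto simp: directed_def)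
      next
        case (insert a F)
        then obtain e e' where "e \<in> E" "F \<subseteq> e" "e' \<in> E" "a \<in> e'" by auto
        then show ?case using E(2) unfolding directed_def by (meson insert_subset order_trans subsetD)
      qed
      show ?thesis
      proof
        fix b assume "b \<in> h (\<Union>E)"
        then obtain \<beta> where b: "fset \<beta> \<subseteq> \<Union>E" "b \<in> m (fset \<beta>)" by (auto simp: h_def)
        then obtain e where "e \<in> E" "fset \<beta> \<subseteq> e" using fin[of "fset \<beta>"] by auto
        then show "b \<in> \<Union>(h ` E)" using b by (auto simp: h_def)
      qed
    qed
    have hc: "scott_cont A A h" using hmono by (intro scott_contI[OF A A] hA hE) auto
    have "\<Inter>D = fun_code A h"
    proof (rule set_eqI)
      fix t
      have "t \<in> \<Inter>D \<longleftrightarrow> (\<forall>g\<in>D. t \<in> fun_code A (fun_apply g))" using Dc(2) by simp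
      also have "\<dots> \<longleftrightarrow> t \<in> fun_code A h"
      proof
        assume L: "\<forall>g\<in>D. t \<in> fun_code A (fun_apply g)"
        then obtain \<beta> b where t: "t = Step \<beta> b" using ne by (auto simp: fun_code_def)
        have "b \<in> h z" if z: "z \<in> A" "fset \<beta> \<subseteq> z" for z
        proof -
          have "b \<in> m (fset \<beta>)" using L t least_above(1,2)[OF A z] by (auto simp: m_def)
          then show ?thesis using z by (auto simp: h_def)
        qed
        then show "t \<in> fun_code A h" using t by simp
      next
        assume "t \<in> fun_code A h"
        then obtain \<beta> b where t: "t = Step \<beta> b" "\<forall>x\<in>A. fset \<beta> \<subseteq> x \<longrightarrow> b \<in> h x"
          by (auto simp: fun_code_def)
        have "b \<in> fun_apply g z" if g: "g \<in> D" and z: "z \<in> A" "fset \<beta> \<subseteq> z" for g z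
        proof -
          obtain \<gamma> where c: "fset \<gamma> \<subseteq> z" "b \<in> m (fset \<gamma>)" using t(2) z by (auto simp: h_def)
          then have "b \<in> fun_apply g (least_above A (fset \<gamma>))" using g by (auto simp: m_def)
          then show ?thesis using Dmono[OF g _ z(1)] least_above[OF A z(1) c(1)] by blast
        qed
        then show "\<forall>g\<in>D. t \<in> fun_code A (fun_apply g)" using t(1) by auto
      qed
      finally show "t \<in> \<Inter>D \<longleftrightarrow> t \<in> fun_code A h" .
    qed
    then show ?thesis using hc by blast
  qed
  show ?thesis using U I by blast
  qed
  then show ?thesis unfolding closed_family_def by simp
qed

lemma closed_family_flat: "closed_family (insert {} ((\<lambda>s. {Point s}) ` X))" (is "closed_family ?F")
proof -
  have down: "y \<in> ?F" if x: "x \<in> ?F" and y: "y \<subseteq> x" for x y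
  proof -
    consider "x = {}" | s where "s \<in> X" "x = {Point s}" using x by blast
    then show ?thesis using y by cases (auto simp: subset_singleton_iff)
  qed
  have U: "\<Union>D \<in> ?F" if D: "D \<subseteq> ?F" "directed D" for D
    proof (cases "D \<subseteq> {{}}")
      case True
      then have "\<Union>D = {}" by blast
      then show ?thesis by simp
    next
      case False
      then obtain x where x: "x \<in> D" "x \<noteq> {}" by blast
      have "d \<subseteq> x" if d: "d \<in> D" for d
      proof -
        obtain c where c: "c \<in> D" "d \<subseteq> c" "x \<subseteq> c"
          using bspec[OF bspec[OF conjunct2[OF D(2)[unfolded directed_def]] d] x(1)] by blast
        have "c \<in> ?F" using c(1) D(1) by (rule rev_subsetD)
        then show ?thesis using c x(2) by auto
      qed
      then have "\<Union>D = x" using x(1) by blast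
      then show ?thesis using subsetD[OF D(1) x(1)] by simp
    qed
  have I: "\<Inter>S \<in> ?F" if S: "S \<subseteq> ?F" "S \<noteq> {}" for S
  proof -
    from S obtain x where x: "x \<in> S" by blast
    from S(1) x have "x \<in> ?F" by (rule subsetD)
    then show ?thesis by (rule down) (use x in blast)
  qed
  show ?thesis unfolding closed_family_def using U I by simp
qed

lemma closed_family_K: "closed_family (K n)"
proof (induction n)
  case 0
  show ?case unfolding K.simps by (rule closed_family_flat)
next
  case (Suc n)
  then show ?case unfolding K.simps by (rule closed_family_fun_space)
qed

theorem fun_apply_code:
  assumes "scott_cont (K n) (K n) f"
  shows "fun_code (K n) f \<in> K (Suc n)" "x \<in> K n \<Longrightarrow> fun_apply (fun_code (K n) f) x = f x"
proof -
  show "fun_code (K n) f \<in> K (Suc n)" unfolding K.simps using assms by blast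
  show "x \<in> K n \<Longrightarrow> fun_apply (fun_code (K n) f) x = f x"
    by (rule fun_apply_code_family[OF closed_family_K assms])
qed

theorem fun_code_apply:
  assumes "g \<in> K (Suc n)"
  shows "scott_cont (K n) (K n) (fun_apply g)" "fun_code (K n) (fun_apply g) = g"
  using fun_code_apply_family[OF closed_family_K assms[unfolded K.simps]] .

theorem fun_code_subset_iff:
  assumes "scott_cont (K n) (K n) f" "scott_cont (K n) (K n) g"
  shows "fun_code (K n) f \<subseteq> fun_code (K n) g \<longleftrightarrow> (\<forall>x\<in>K n. f x \<subseteq> g x)"
  by (rule fun_code_subset_iff_family[OF closed_family_K assms])


subsection \<open>The inverse limit\<close>

text \<open>
  \<open>emb n\<close> and \<open>proj n\<close> are \<open>f\<^sub>n\<^sup>+ : K\<^sub>n \<rightarrow> K\<^sub>n\<^sub>+\<^sub>1\<close> and \<open>f\<^sub>n\<^sup>- : K\<^sub>n\<^sub>+\<^sub>1 \<rightarrow> K\<^sub>n\<close>. At the bottom stage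
  they are the standard ones: constant functions, and evaluation at bottom. Off the carriers
  the values are irrelevant.
\<close>

fun emb proj :: "nat \<Rightarrow> elem \<Rightarrow> elem" where
  "emb 0 x = fun_code (K 0) (\<lambda>_. x)"
| "proj 0 g = fun_apply g {}"
| "emb (Suc n) g = fun_code (K (Suc n)) (\<lambda>x. emb n (fun_apply g (proj n x)))"
| "proj (Suc n) h = fun_code (K n) (\<lambda>x. proj n (fun_apply h (emb n x)))"

lemma scott_cont_comp:
  assumes f: "scott_cont A B f" and g: "scott_cont B C g"
  shows "scott_cont A C (\<lambda>x. g (f x))"
  unfolding scott_cont_def
proof (intro conjI allI impI)
  show "(\<lambda>x. g (f x)) ` A \<subseteq> C" using scott_cont_maps[OF f] scott_cont_maps[OF g] by auto
  fix D u assume D: "D \<subseteq> A" "directed D" "is_lub_in A D u"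
  have "f ` D \<subseteq> B" using scott_cont_maps[OF f] D(1) by auto
  moreover have "directed (f ` D)" using D(2,1) scott_cont_mono[OF f] by (rule directed_image)
  moreover have "is_lub_in B (f ` D) (f u)" using f D by (simp add: scott_cont_def)
  ultimately have "is_lub_in C (g ` f ` D) (g (f u))" using g by (simp add: scott_cont_def)
  then show "is_lub_in C ((\<lambda>x. g (f x)) ` D) (g (f u))" by (simp add: image_image)
qed

lemma fun_code_subset_Union:
  assumes A: "closed_family A" and "D \<noteq> {}" and F: "\<And>g. g \<in> D \<Longrightarrow> scott_cont A A (F g)"
    and f: "\<And>x. x \<in> A \<Longrightarrow> f x \<subseteq> (\<Union>g\<in>D. F g x)"
  shows "fun_code A f \<subseteq> (\<Union>g\<in>D. fun_code A (F g))"
proof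
  fix t assume "t \<in> fun_code A f"
  then obtain \<beta> b where t: "t = Step \<beta> b" "\<And>x. x \<in> A \<Longrightarrow> fset \<beta> \<subseteq> x \<Longrightarrow> b \<in> f x"
    by (auto simp: fun_code_def)
  show "t \<in> (\<Union>g\<in>D. fun_code A (F g))"
  proof (cases "\<exists>x\<in>A. fset \<beta> \<subseteq> x")
    case True
    then obtain x where x: "x \<in> A" "fset \<beta> \<subseteq> x" by blast
    let ?c = "least_above A (fset \<beta>)"
    note c = least_above[OF A x]
    obtain g where g: "g \<in> D" "b \<in> F g ?c" using t(2)[OF c(1,2)] f[OF c(1)] by blast
    have "b \<in> F g z" if z: "z \<in> A" "fset \<beta> \<subseteq> z" for z
      using g(2) scott_cont_mono[OF F[OF g(1)] c(1) z(1) least_above(3)[OF A z]] by (rule rev_subsetD)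
    then have "t \<in> fun_code A (F g)" using t(1) by simp
    then show ?thesis using g(1) by blast
  next
    case False
    obtain g where g: "g \<in> D" using \<open>D \<noteq> {}\<close> by blast
    have "t \<in> fun_code A (F g)" using False t(1) by auto
    then show ?thesis using g by blast
  qed
qed

lemma scott_cont_conjugate:
  assumes p: "scott_cont (K m) (K n) p" and q: "scott_cont (K n) (K m) q"
  shows "scott_cont (K (Suc m)) (K (Suc n)) (\<lambda>g. fun_code (K n) (\<lambda>x. p (fun_apply g (q x))))"
    and "g \<in> K (Suc m) \<Longrightarrow> scott_cont (K n) (K n) (\<lambda>x. p (fun_apply g (q x)))"
proof -
  note cl = closed_family_K
  have c: "scott_cont (K n) (K n) (\<lambda>x. p (fun_apply g (q x)))" if g: "g \<in> K (Suc m)" for g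
    by (rule scott_cont_comp[OF scott_cont_comp[OF q fun_code_apply(1)[OF g]] p])
  then show "g \<in> K (Suc m) \<Longrightarrow> scott_cont (K n) (K n) (\<lambda>x. p (fun_apply g (q x)))" .
  have in_K: "fun_apply g (q x) \<in> K m" if "g \<in> K (Suc m)" "x \<in> K n" for g x
    using scott_cont_maps[OF fun_code_apply(1)[OF that(1)] scott_cont_maps[OF q that(2)]] .
  show "scott_cont (K (Suc m)) (K (Suc n)) (\<lambda>g. fun_code (K n) (\<lambda>x. p (fun_apply g (q x))))"
  proof (rule scott_contI[OF cl cl])
    show "fun_code (K n) (\<lambda>x. p (fun_apply g (q x))) \<in> K (Suc n)" if "g \<in> K (Suc m)" for g
      by (rule fun_apply_code(1)[OF c[OF that]])
    show "fun_code (K n) (\<lambda>x. p (fun_apply g (q x))) \<subseteq> fun_code (K n) (\<lambda>x. p (fun_apply h (q x)))"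
      if "g \<in> K (Suc m)" "h \<in> K (Suc m)" "g \<subseteq> h" for g h
      unfolding fun_code_subset_iff[OF c[OF that(1)] c[OF that(2)]]
      using scott_cont_mono[OF p in_K[OF that(1)] in_K[OF that(2)] fun_apply_mono[OF that(3)]] by simp
    show "fun_code (K n) (\<lambda>x. p (fun_apply (\<Union>D) (q x)))
            \<subseteq> \<Union>((\<lambda>g. fun_code (K n) (\<lambda>x. p (fun_apply g (q x)))) ` D)"
      if D: "D \<subseteq> K (Suc m)" "directed D" for D
    proof (rule fun_code_subset_Union[OF cl])
      show "D \<noteq> {}" using D(2) by (simp add: directed_def)
      show "scott_cont (K n) (K n) (\<lambda>x. p (fun_apply g (q x)))" if "g \<in> D" for g
        by (rule c[OF subsetD[OF D(1) that]])
      fix x assume x: "x \<in> K n"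
      let ?E = "(\<lambda>g. fun_apply g (q x)) ` D"
      have "directed ?E" by (rule directed_image[OF D(2) subset_UNIV]) (rule fun_apply_mono)
      moreover have "?E \<subseteq> K m" using in_K[OF subsetD[OF D(1)] x] by (rule image_subsetI)
      ultimately have "p (\<Union>?E) = \<Union>(p ` ?E)" by (intro scott_cont_Union[OF cl cl p])
      then show "p (fun_apply (\<Union>D) (q x)) \<subseteq> (\<Union>g\<in>D. p (fun_apply g (q x)))"
        by (simp add: fun_apply_Union image_image)
    qed
  qed
qed

theorem projection_pair:
  shows "scott_cont (K n) (K (Suc n)) (emb n)" and "scott_cont (K (Suc n)) (K n) (proj n)"
    and "x \<in> K n \<Longrightarrow> proj n (emb n x) = x" and "y \<in> K (Suc n) \<Longrightarrow> emb n (proj n y) \<subseteq> y"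
proof -
  note cl = closed_family_K
  have "scott_cont (K n) (K (Suc n)) (emb n) \<and> scott_cont (K (Suc n)) (K n) (proj n) \<and>
    (\<forall>x\<in>K n. proj n (emb n x) = x) \<and> (\<forall>y\<in>K (Suc n). emb n (proj n y) \<subseteq> y)"
  proof (induction n)
    case 0
    have bot: "{} \<in> K 0" by simp
    have const: "scott_cont (K 0) (K 0) (\<lambda>_. x)" if x: "x \<in> K 0" for x
    proof (rule scott_contI[OF cl cl])
      show "x \<subseteq> \<Union>((\<lambda>_. x) ` D)" if "directed D" for D :: "elem set"
        using that by (auto simp: directed_def)
    qed (use x in simp_all)
    have "scott_cont (K 0) (K (Suc 0)) (emb 0)"
    proof (rule scott_contI[OF cl cl])
      show "emb 0 x \<in> K (Suc 0)" if "x \<in> K 0" for x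
        unfolding emb.simps by (rule fun_apply_code(1)[OF const[OF that]])
      show "emb 0 x \<subseteq> emb 0 y" if "x \<in> K 0" "y \<in> K 0" "x \<subseteq> y" for x y
        unfolding emb.simps fun_code_subset_iff[OF const[OF that(1)] const[OF that(2)]]
        using that(3) by simp
      show "emb 0 (\<Union>D) \<subseteq> \<Union>(emb 0 ` D)" if D: "D \<subseteq> K 0" "directed D" for D
        unfolding emb.simps
      proof (rule fun_code_subset_Union[OF cl])
        show "D \<noteq> {}" using D(2) by (simp add: directed_def)
        show "scott_cont (K 0) (K 0) (\<lambda>_. x)" if "x \<in> D" for x
          by (rule const[OF subsetD[OF D(1) that]])
      qed simp
    qed
    moreover have "scott_cont (K (Suc 0)) (K 0) (proj 0)"
    proof (rule scott_contI[OF cl cl])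
      show "proj 0 g \<in> K 0" if "g \<in> K (Suc 0)" for g
        unfolding proj.simps by (rule scott_cont_maps[OF fun_code_apply(1)[OF that] bot])
      show "proj 0 g \<subseteq> proj 0 h" if "g \<subseteq> h" for g h
        unfolding proj.simps by (rule fun_apply_mono[OF that])
      show "proj 0 (\<Union>D) \<subseteq> \<Union>(proj 0 ` D)" for D by (simp add: fun_apply_Union)
    qed
    moreover have "proj 0 (emb 0 x) = x" if "x \<in> K 0" for x
      unfolding emb.simps proj.simps by (rule fun_apply_code(2)[OF const[OF that] bot])
    moreover have "emb 0 (proj 0 g) \<subseteq> g" if g: "g \<in> K (Suc 0)" for g
    proof -
      note a = fun_code_apply[OF g]
      have "fun_apply g {} \<subseteq> fun_apply g x" if x: "x \<in> K 0" for x
        by (rule scott_cont_mono[OF a(1) bot x]) simp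
      then have "fun_code (K 0) (\<lambda>_. fun_apply g {}) \<subseteq> fun_code (K 0) (fun_apply g)"
        using fun_code_subset_iff[OF const[OF scott_cont_maps[OF a(1) bot]] a(1)] by blast
      then show ?thesis by (simp only: emb.simps proj.simps a(2))
    qed
    ultimately show ?case by blast
  next
    case (Suc n)
    then have e: "scott_cont (K n) (K (Suc n)) (emb n)" and p: "scott_cont (K (Suc n)) (K n) (proj n)"
      and pe: "\<And>x. x \<in> K n \<Longrightarrow> proj n (emb n x) = x"
      and ep: "\<And>y. y \<in> K (Suc n) \<Longrightarrow> emb n (proj n y) \<subseteq> y" by blast+
    have e': "scott_cont (K (Suc n)) (K (Suc (Suc n))) (emb (Suc n))"
      using scott_cont_conjugate(1)[OF e p] by (simp only: emb.simps(2)[abs_def])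
    have p': "scott_cont (K (Suc (Suc n))) (K (Suc n)) (proj (Suc n))"
      using scott_cont_conjugate(1)[OF p e] by (simp only: proj.simps(2)[abs_def])
    have "proj (Suc n) (emb (Suc n) g) = g" if g: "g \<in> K (Suc n)" for g
    proof -
      have "proj n (fun_apply (emb (Suc n) g) (emb n x)) = fun_apply g x" if x: "x \<in> K n" for x
      proof -
        have "fun_apply (emb (Suc n) g) (emb n x) = emb n (fun_apply g (proj n (emb n x)))"
          unfolding emb.simps
          by (rule fun_apply_code(2)[OF scott_cont_conjugate(2)[OF e p g] scott_cont_maps[OF e x]])
        then show ?thesis
          by (simp only: pe[OF x] pe[OF scott_cont_maps[OF fun_code_apply(1)[OF g] x]])
      qed
      then have "proj (Suc n) (emb (Suc n) g) = fun_code (K n) (fun_apply g)"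
        unfolding proj.simps by (rule fun_code_eqI)
      then show ?thesis using fun_code_apply(2)[OF g] by simp
    qed
    moreover have "emb (Suc n) (proj (Suc n) h) \<subseteq> h" if h: "h \<in> K (Suc (Suc n))" for h
    proof -
      note a = fun_code_apply[OF h]
      have ph: "proj (Suc n) h \<in> K (Suc n)" by (rule scott_cont_maps[OF p' h])
      have "emb n (fun_apply (proj (Suc n) h) (proj n x)) \<subseteq> fun_apply h x" if x: "x \<in> K (Suc n)" for x
      proof -
        have px: "proj n x \<in> K n" by (rule scott_cont_maps[OF p x])
        have epx: "emb n (proj n x) \<in> K (Suc n)" by (rule scott_cont_maps[OF e px])
        have hx: "fun_apply h (emb n (proj n x)) \<in> K (Suc n)" by (rule scott_cont_maps[OF a(1) epx])
        have "fun_apply (proj (Suc n) h) (proj n x) = proj n (fun_apply h (emb n (proj n x)))"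
          unfolding proj.simps by (rule fun_apply_code(2)[OF scott_cont_conjugate(2)[OF p e h] px])
        then have "emb n (fun_apply (proj (Suc n) h) (proj n x)) \<subseteq> fun_apply h (emb n (proj n x))"
          using ep[OF hx] by simp
        also have "\<dots> \<subseteq> fun_apply h x" by (rule scott_cont_mono[OF a(1) epx x ep[OF x]])
        finally show ?thesis .
      qed
      then have "emb (Suc n) (proj (Suc n) h) \<subseteq> fun_code (K (Suc n)) (fun_apply h)"
        unfolding emb.simps fun_code_subset_iff[OF scott_cont_conjugate(2)[OF e p ph] a(1)] by blast
      then show ?thesis using a(2) by simp
    qed
    ultimately show ?case using e' p' by blast
  qed
  then show "scott_cont (K n) (K (Suc n)) (emb n)" "scott_cont (K (Suc n)) (K n) (proj n)"
    "x \<in> K n \<Longrightarrow> proj n (emb n x) = x" "y \<in> K (Suc n) \<Longrightarrow> emb n (proj n y) \<subseteq> y" by blast+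
qed

definition K_inf :: "(nat \<Rightarrow> elem) set" where
  "K_inf = {x. \<forall>n. x n \<in> K n \<and> proj n (x (Suc n)) = x n}"

text \<open>\<open>emb_inf\<close> is \<open>f\<^bsub>0,\<infinity>\<^esub> : K\<^sub>0 \<rightarrow> K\<^sub>\<infinity>\<close>.\<close>

primrec emb_inf :: "elem \<Rightarrow> nat \<Rightarrow> elem" where
  "emb_inf x 0 = x"
| "emb_inf x (Suc n) = emb n (emb_inf x n)"

definition right_pole :: elem where
  "right_pole = {Point (1, \<lambda>i. if i = 0 then 1 else 0)}"

definition left_pole :: elem where
  "left_pole = {Point (1, \<lambda>i. if i = 0 then - 1 else 0)}"


section \<open>The identity-type tower on a set\<close>

text \<open>
  \<open>Identity p q\<close> stands for the inhabitant of the identity type \<open>p = q\<close>. Equal cells are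
  automatically parallel, so parallelism need not be demanded separately.
\<close>

datatype 'a cell = Object 'a | Identity "'a cell" "'a cell"

primrec cells :: "'a set \<Rightarrow> nat \<Rightarrow> 'a cell set" where
  "cells A 0 = Object ` A"
| "cells A (Suc n) = {Identity p q | p q. p \<in> cells A n \<and> q \<in> cells A n \<and> p = q}"

primrec source_point :: "'a cell \<Rightarrow> 'a" where
  "source_point (Object x) = x"
| "source_point (Identity p q) = source_point p"

primrec target_point :: "'a cell \<Rightarrow> 'a" where
  "target_point (Object x) = x"
| "target_point (Identity p q) = target_point q"

definition connected_by_cell :: "'a set \<Rightarrow> nat \<Rightarrow> 'a \<Rightarrow> 'a \<Rightarrow> bool" where
  "connected_by_cell A n x y \<longleftrightarrow> (\<exists>c\<in>cells A n. source_point c = x \<and> target_point c = y)"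


section \<open>Beta and eta steps on lambda terms\<close>

text \<open>Terms modulo renaming of bound variables, in de Bruijn notation.\<close>

datatype trm = Var nat | App trm trm | Lam trm

primrec lift :: "nat \<Rightarrow> trm \<Rightarrow> trm" where
  "lift k (Var i) = (if i < k then Var i else Var (Suc i))"
| "lift k (App s t) = App (lift k s) (lift k t)"
| "lift k (Lam s) = Lam (lift (Suc k) s)"

primrec subst :: "nat \<Rightarrow> trm \<Rightarrow> trm \<Rightarrow> trm" where
  "subst k u (Var i) = (if i < k then Var i else if i = k then u else Var (i - 1))"
| "subst k u (App s t) = App (subst k u s) (subst k u t)"
| "subst k u (Lam s) = Lam (subst (Suc k) (lift 0 u) s)"

datatype rule = By_beta | By_eta

datatype direction = Function_part | Argument_part | Lambda_body

inductive contracts :: "rule \<Rightarrow> direction list \<Rightarrow> trm \<Rightarrow> trm \<Rightarrow> bool" where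
  beta: "contracts By_beta [] (App (Lam s) u) (subst 0 u s)"
| eta: "contracts By_eta [] (Lam (App (lift 0 s) (Var 0))) s"
| fun_part: "contracts r p s s' \<Longrightarrow> contracts r (Function_part # p) (App s u) (App s' u)"
| arg_part: "contracts r p u u' \<Longrightarrow> contracts r (Argument_part # p) (App s u) (App s u')"
| body: "contracts r p s s' \<Longrightarrow> contracts r (Lambda_body # p) (Lam s) (Lam s')"


section \<open>The fixed-span witness language\<close>

text \<open>The span is \<open>(\<lambda>z. x z) y \<rightarrow> x y\<close>; under the binder the free variable \<open>x\<close> has index \<open>Suc x\<close>.\<close>

definition span_source :: "nat \<Rightarrow> nat \<Rightarrow> trm" where
  "span_source x y = App (Lam (App (Var (Suc x)) (Var 0))) (Var y)"

definition span_target :: "nat \<Rightarrow> nat \<Rightarrow> trm" where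
  "span_target x y = App (Var x) (Var y)"

datatype witness = Contraction rule "direction list" trm trm | Refl trm | Comp witness witness

definition t_beta :: "nat \<Rightarrow> nat \<Rightarrow> witness" where
  "t_beta x y = Contraction By_beta [] (span_source x y) (span_target x y)"

definition t_eta :: "nat \<Rightarrow> nat \<Rightarrow> witness" where
  "t_eta x y = Contraction By_eta [Function_part] (span_source x y) (span_target x y)"

lemma contracts_t_beta: "contracts By_beta [] (span_source x y) (span_target x y)"
  using contracts.beta[of "App (Var (Suc x)) (Var 0)" "Var y"]
  by (simp add: span_source_def span_target_def)

lemma contracts_t_eta: "contracts By_eta [Function_part] (span_source x y) (span_target x y)"
  using contracts.fun_part[OF contracts.eta[of "Var x"], of "Var y"]
  by (simp add: span_source_def span_target_def)

inductive has_type :: "nat \<Rightarrow> nat \<Rightarrow> witness \<Rightarrow> trm \<Rightarrow> trm \<Rightarrow> bool" for x y where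
  "has_type x y (t_beta x y) (span_source x y) (span_target x y)"
| "has_type x y (t_eta x y) (span_source x y) (span_target x y)"
| "has_type x y (Refl (span_source x y)) (span_source x y) (span_source x y)"
| "has_type x y (Refl (span_target x y)) (span_target x y) (span_target x y)"
| "has_type x y s A B \<Longrightarrow> has_type x y t B C \<Longrightarrow> has_type x y (Comp s t) A C"

definition W :: "nat \<Rightarrow> nat \<Rightarrow> trm \<Rightarrow> trm \<Rightarrow> witness set" where
  "W x y A B = {t. has_type x y t A B}"

text \<open>
  The tag of a witness is the rule of its contraction; purely reflexive witnesses have none.
  In \<open>Comp s t\<close> at most one factor contains a contraction (\<open>W_span_induct\<close>), so the order of
  the case distinction does not matter.
\<close>

primrec tag :: "witness \<Rightarrow> rule option" where
  "tag (Contraction r p A B) = Some r"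
| "tag (Refl A) = None"
| "tag (Comp s t) = (case tag s of Some r \<Rightarrow> Some r | None \<Rightarrow> tag t)"

lemma span_source_neq_target [simp]:
  "span_source x y \<noteq> span_target x y" "span_target x y \<noteq> span_source x y"
  by (simp_all add: span_source_def span_target_def)

lemma has_type_cases:
  assumes "has_type x y t A B"
  shows "A = span_source x y \<and> B = span_target x y \<and> tag t \<noteq> None \<or>
         A = B \<and> (A = span_source x y \<or> A = span_target x y) \<and> tag t = None"
  using assms by induction (auto simp: t_beta_def t_eta_def split: option.splits)

theorem W_span_induct [consumes 1, case_names beta eta left right]:
  assumes "t \<in> W x y (span_source x y) (span_target x y)"
    and "P (t_beta x y)" and "P (t_eta x y)"
    and "\<And>s t. s \<in> W x y (span_source x y) (span_source x y) \<Longrightarrow> tag s = None \<Longrightarrow>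
           t \<in> W x y (span_source x y) (span_target x y) \<Longrightarrow> P t \<Longrightarrow> P (Comp s t)"
    and "\<And>s t. s \<in> W x y (span_source x y) (span_target x y) \<Longrightarrow> P s \<Longrightarrow>
           t \<in> W x y (span_target x y) (span_target x y) \<Longrightarrow> tag t = None \<Longrightarrow> P (Comp s t)"
  shows "P t"
proof -
  have "has_type x y t A B \<Longrightarrow> A = span_source x y \<Longrightarrow> B = span_target x y \<Longrightarrow> P t" for A B
  proof (induction rule: has_type.induct)
    case (5 s A B t C)
    consider "B = span_source x y" "tag s = None" | "B = span_target x y" "tag t = None"
      using has_type_cases[OF 5(1)] has_type_cases[OF 5(2)] 5(5,6) by auto
    then show ?case using 5 assms(4)[of s t] assms(5)[of s t] by cases (simp_all add: W_def)
  qed (use assms(2,3) in auto)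
  then show ?thesis using assms(1) by (simp add: W_def)
qed

theorem tag_W_span:
  assumes "t \<in> W x y (span_source x y) (span_target x y)"
  shows "\<exists>!r. tag t = Some r"
  using has_type_cases[of x y t] assms by (fastforce simp: W_def)

definition tag_point :: "rule \<Rightarrow> elem" where
  "tag_point r = (case r of By_beta \<Rightarrow> right_pole | By_eta \<Rightarrow> left_pole)"

definition interp :: "witness \<Rightarrow> nat \<Rightarrow> elem" where
  "interp t = emb_inf (tag_point (the (tag t)))"

end

theory Submission
  imports Defs
begin

text \<open>
  The canonical embedding of \<open>K\<^sub>0\<close> into \<open>K\<^sub>\<infinity>\<close> is split by the projection to stage \<open>0\<close>, so the two
  distinct poles stay distinct. A cell of the identity-type tower is in every dimension an
  iterated identity, so its endpoints coincide and it cannot join distinct points.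
\<close>

text \<open>Continuity of each \<open>emb n\<close> keeps every coordinate in its stage; coherence
  of the thread is the retraction law of the projection pairs.\<close>

lemma emb_inf_in_K_inf:
  assumes "x \<in> K 0"
  shows "emb_inf x \<in> K_inf"
proof -
  have in_K: "emb_inf x n \<in> K n" for n
  proof (induction n)
    case 0
    show ?case using assms by (simp only: emb_inf.simps)
  next
    case (Suc n)
    show ?case unfolding emb_inf.simps
      by (rule scott_cont_maps[OF projection_pair(1) Suc.IH])
  qed
  have "proj n (emb_inf x (Suc n)) = emb_inf x n" for n
    unfolding emb_inf.simps by (rule projection_pair(3)[OF in_K])
  with in_K show ?thesis by (simp add: K_inf_def)
qed

text \<open>Evaluation at stage 0 is a left inverse, on all of \<open>elem\<close>.\<close>

lemma inj_emb_inf: "inj emb_inf"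
  by (rule injI) (metis emb_inf.simps(1))

lemma circle_pole_in_K0:
  assumes "c^2 = (1::real)"
  shows "{Point (1, \<lambda>i. if i = 0 then c else 0)} \<in> K 0"
proof -
  \<comment> \<open>\<open>nsphere 1\<close> is the unit circle in coordinates 0 and 1, with all
    later coordinates zero, so membership reduces to \<open>c^2 = 1\<close>.\<close>
  have "(\<lambda>i. if i = 0 then c else 0) \<in> topspace (nsphere 1)"
    using assms by (simp add: nsphere topspace_Euclidean_space)
  then show ?thesis by (auto simp: sphere_points_def)
qed

lemma tag_point_in_K0: "tag_point r \<in> K 0"
  using circle_pole_in_K0[of 1] circle_pole_in_K0[of "-1"]
  by (cases r) (simp_all only: tag_point_def rule.case right_pole_def left_pole_def
    power_one power2_minus simp_thms)

lemma right_pole_neq_left_pole: "right_pole \<noteq> left_pole"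
  by (auto simp: right_pole_def left_pole_def fun_eq_iff)

lemma inj_tag_point: "inj tag_point"
  using right_pole_neq_left_pole
  by (auto intro!: injI simp: tag_point_def split: rule.splits)

lemma interp_in_K_inf: "interp t \<in> K_inf"
  unfolding interp_def by (rule emb_inf_in_K_inf[OF tag_point_in_K0])

text \<open>\<open>interp\<close> factors through the tag by two injective maps,
  \<open>tag_point\<close> and \<open>emb_inf\<close>.\<close>

lemma interp_eq_iff: "interp s = interp t \<longleftrightarrow> the (tag s) = the (tag t)"
  by (simp add: interp_def inj_eq[OF inj_emb_inf] inj_eq[OF inj_tag_point])

text \<open>A cell of successor dimension is \<open>Identity p p\<close>, so its endpoints are those
  of \<open>p\<close>, one dimension lower.\<close>

lemma source_point_eq_target_point: "c \<in> cells A n \<Longrightarrow> source_point c = target_point c"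
  by (induction n arbitrary: c) auto

lemma connected_by_cell_imp_eq: "connected_by_cell A n x y \<Longrightarrow> x = y"
  by (auto simp: connected_by_cell_def dest: source_point_eq_target_point)

theorem theoremC:
  fixes x y :: nat
  assumes "x \<noteq> y"
  shows "(interp (t_beta x y) \<in> K_inf \<and> interp (t_eta x y) \<in> K_inf
         \<and> interp (t_beta x y) \<noteq> interp (t_eta x y)
         \<and> \<not> connected_by_cell K_inf 1 (interp (t_beta x y)) (interp (t_eta x y))
         \<and> (\<forall>n>0. \<not> connected_by_cell K_inf n (interp (t_beta x y)) (interp (t_eta x y))))
    \<and> (\<forall>s \<in> W x y (span_source x y) (span_target x y).
        \<forall>t \<in> W x y (span_source x y) (span_target x y).
          tag s = Some By_beta \<longrightarrow> tag t = Some By_eta \<longrightarrow>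
            interp s \<in> K_inf \<and> interp t \<in> K_inf
          \<and> interp s \<noteq> interp t
          \<and> \<not> connected_by_cell K_inf 1 (interp s) (interp t)
          \<and> (\<forall>n>0. \<not> connected_by_cell K_inf n (interp s) (interp t)))"
proof -
  \<comment> \<open>Only the tags matter here, so this serves both the direct witnesses and all
    padded ones in \<open>W\<close>.\<close>
  have separated: "interp s \<in> K_inf \<and> interp t \<in> K_inf \<and> interp s \<noteq> interp t
      \<and> \<not> connected_by_cell K_inf 1 (interp s) (interp t)
      \<and> (\<forall>n>0. \<not> connected_by_cell K_inf n (interp s) (interp t))"
    if "tag s = Some By_beta" "tag t = Some By_eta" for s t
  proof -
    have "interp s \<noteq> interp t" using that by (simp add: interp_eq_iff)
    then show ?thesis by (auto simp: interp_in_K_inf dest: connected_by_cell_imp_eq)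
  qed
  moreover have "tag (t_beta x y) = Some By_beta" "tag (t_eta x y) = Some By_eta"
    by (simp_all add: t_beta_def t_eta_def)
  ultimately show ?thesis by blast
qed

end
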